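(* For integers $\mu\ge1$, $n\ge 2$, $s\ge 2$, \[ \begin{split} &\sum_{\nu = 1}^\infty \frac{H_{\nu ,n} }{(\nu + \mu )^s } + \sum_{\nu = 1}^\infty \frac{H_{\nu ,s} }{(\nu + \mu )^n } = H_{\mu ,n + s} - H_{\mu ,n} H_{\mu ,s}- \zeta (n + s) + \zeta (n)\zeta (s)\\ &\quad- \sum_{j = 0}^{n - 2} \binom{s+j-1}j\left[ ( - 1)^j + ( - 1)^s \right]\zeta (n - j)H_{\mu - 1,s + j} - \sum_{j = 0}^{s - 2} \binom{n+j-1}j\left[ ( - 1)^j + ( - 1)^n \right]\zeta (s - j)H_{\mu - 1,n + j} \\ &\quad+ ( - 1)^n \sum_{j = 0}^{s - 1} \binom{n+j-1}jH_{\mu ,s - j} H_{\mu - 1,n + j} + ( - 1)^s \sum_{j = 0}^{n - 1} \binom{s+j-1}jH_{\mu ,n - j} H_{\mu - 1,s + j} \\ &\quad+ \sum_{j = 0}^{n - 1} \binom{s+j-1}j( - 1)^j \sum_{k = 1}^{s + j} \binom{n+s-k-1}{n-j-1}\sum_{i = 1}^\mu \frac{H_{i - 1,k} }{i^{n + s - k} } + \sum_{j = 0}^{s - 1} \binom{n+j-1}j( - 1)^j \sum_{k = 1}^{n + j} \binom{n+s-k-1}{s-j-1}\sum_{i = 1}^\mu \frac{H_{i - 1,k} }{i^{n + s - k} }\\ &\quad+ \sum_{j = 0}^{n - 1} \binom{s+j-1}j( - 1)^j \sum_{k = 1}^{n - j} \binom{n+s-k-1}{s+j-1}\sum_{i =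 1}^\mu \frac{H_{i - 1,k} }{i^{n + s - k} } + \sum_{j = 0}^{s - 1} \binom{n+j-1}j( - 1)^j \sum_{k = 1}^{s - j} \binom{n+s-k-1}{n+j-1}\sum_{i = 1}^\mu \frac{H_{i - 1,k} }{i^{n + s - k} }. \end{split} \] In particular, for $n,s\ge2$, \[ \sum_{\nu = 1}^\infty \frac{H_{\nu ,n} }{(\nu + 1 )^s } + \sum_{\nu = 1}^\infty \frac{H_{\nu ,s} }{(\nu + 1 )^n }=\zeta (n)\zeta (s) - \zeta (n + s), \] and for $\mu\ge1$, $n\ge2$, \[ \begin{split} &2\sum_{\nu = 1}^\infty \frac{H_{\nu ,n} }{(\nu + \mu )^n } = H_{\mu ,2n} - \zeta (2n) - H_{\mu ,n}^2 + \zeta (n)^2 + ( - 1)^{n - 1} 4\sum_{j = 1}^{\lfloor n/2\rfloor } \binom{2n-2j-1}{n-1}\zeta (2j)H_{\mu - 1,2n - 2j} \\ &\quad - ( - 1)^{n - 1} 2\sum_{j = 1}^n \binom{2n-j-1}{n-1}( - 1)^j H_{\mu - 1,2n - j} H_{\mu ,j} - ( - 1)^{n - 1} 2\sum_{j = 1}^n \binom{2n-j-1}{n-1}( - 1)^j \sum_{k = 1}^{2n - j} \binom{2n-k-1}{j-1}\sum_{i = 1}^\mu \frac{H_{i - 1,k} }{i^{2n - k} }\\ &\quad - ( - 1)^{n - 1} 2\sum_{j = 1}^n \binom{2n-j-1}{n-1}( - 1)^j \sum_{k = 1}^j \binom{2n-k-1}{2n-j-1}\sum_{i = 1}^\mu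 \frac{H_{i - 1,k} }{i^{2n - k} }. \end{split} \]
   Context: For integers $m\ge0$ and $n$, $H_{m,n}=\sum_{k=1}^m k^{-n}$ (with $H_{0,n}=0$); $\zeta$ is the Riemann zeta function.
   Formalization: In the last display (case s = n), the factor (-1)^j in the sum of binom(2n-j-1,n-1) H_{mu-1,2n-j} H_{mu,j} is dropped: as printed the formula is false for every mu >= 2 (for n = mu = 2 it is off by 12) and disagrees with the main identity at s = n. *)

theory Defs
  imports "HOL-Analysis.Analysis"
begin

definition H :: "nat \<Rightarrow> int \<Rightarrow> real" where
  "H m n = (\<Sum>k=1..m. real k powi (- n))"

(* The Riemann zeta function on the real half-line s > 1, where it is given by its
   Dirichlet series.  For s <= 1 the series diverges and the value is meaningless. *)
definition zeta :: "real \<Rightarrow> real" where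
  "zeta s = (\<Sum>k. 1 / real (Suc k) powr s)"

end

(* Let F(mu) be the sum of the two series. Telescoping H_{N,n} H_{N,s} in N evaluates F(1).
   Shifting the summation index gives
     F(mu) - F(mu+1) = sum_nu (1 / (nu^n (nu+mu)^s) + 1 / (nu^s (nu+mu)^n)),
   which partial fractions express through zeta values and the numbers H_{mu,k}. After summation
   by parts, all that is left is to recognise the binomial double sums: exchanging the order of
   summation, those of the first kind collapse by the Vandermonde identity
   (1+x)^(-s) (1+x)^K = (1+x)^(K-s), and those of the second kind by the vanishing of alternating
   row sums of Pascal's triangle. *)

theory Submission
  imports Defs "HOL-Real_Asymp.Real_Asymp"
begin

section \<open>Power sums with natural exponents, zeta values and zeta tails\<close>

text \<open>\<open>H\<close> for exponents in \<open>nat\<close>, so that ordinary powers replace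
  \<open>powi\<close>. \<open>H_int\<close> translates back at the very end.\<close>

definition harm_pow :: "nat \<Rightarrow> nat \<Rightarrow> real" where
  "harm_pow m k = (\<Sum>i=1..m. 1 / real i ^ k)"

lemma H_int: "H m (int k) = harm_pow m k"
  by (simp add: H_def harm_pow_def power_int_minus field_simps)

lemma harm_pow_0 [simp]: "harm_pow 0 k = 0"
  by (simp add: harm_pow_def)

lemma harm_pow_Suc: "harm_pow (Suc m) k = harm_pow m k + 1 / real (Suc m) ^ k"
  by (simp add: harm_pow_def)

lemma harm_pow_eq_sum_lessThan: "harm_pow m k = (\<Sum>i<m. 1 / real (Suc i) ^ k)"
  by (induction m) (simp_all add: harm_pow_Suc)

lemma zeta_sums:
  assumes "k \<ge> 2"
  shows "(\<lambda>i. 1 / real (Suc i) ^ k) sums zeta (real k)"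
proof -
  have "summable (\<lambda>i. inverse (real i ^ k))"
    using inverse_power_summable[of k, where ?'a = real] assms by simp
  then have "summable (\<lambda>i. 1 / real (Suc i) ^ k)"
    by (subst (asm) summable_Suc_iff[symmetric]) (simp add: field_simps)
  moreover have "zeta (real k) = (\<Sum>i. 1 / real (Suc i) ^ k)"
    unfolding zeta_def by (intro suminf_cong) (subst powr_realpow, auto)
  ultimately show ?thesis
    by (simp add: summable_sums)
qed

lemma harm_pow_tendsto_zeta:
  assumes "k \<ge> 2"
  shows "(\<lambda>m. harm_pow m k) \<longlonglongrightarrow> zeta (real k)"
  using zeta_sums[OF assms] unfolding sums_def harm_pow_eq_sum_lessThan .

lemma harm_pow_le_zeta:
  assumes "k \<ge> 2"
  shows "harm_pow m k \<le> zeta (real k)"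
  unfolding harm_pow_eq_sum_lessThan
  using sum_le_suminf[of "\<lambda>i. 1 / real (Suc i) ^ k" "{..<m}"] zeta_sums[OF assms]
  by (auto simp: sums_iff)

lemma harm_pow_nonneg: "harm_pow m k \<ge> 0"
  by (simp add: harm_pow_def sum_nonneg)

lemma zeta_tail_sums:
  assumes "k \<ge> 2"
  shows "(\<lambda>i. 1 / real (Suc i + d) ^ k) sums (zeta (real k) - harm_pow d k)"
  using sums_split_initial_segment[OF zeta_sums[OF assms], of d]
  by (simp add: harm_pow_eq_sum_lessThan)

text \<open>Stands in for \<open>zeta_tail_sums\<close> at exponent 1, where the two series diverge
  separately. Raising \<open>d\<close> by one adds a telescoping series with sum 1 / (d +
  1).\<close>

lemma reciprocal_diff_sums: "(\<lambda>i. 1 / real (Suc i) - 1 / real (Suc i + d)) sums harm_pow d 1"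
proof (induction d)
  case 0
  then show ?case by simp
next
  case (Suc d)
  have "(\<lambda>i. 1 / real (Suc i + d)) \<longlonglongrightarrow> 0"
    by real_asymp
  then have "(\<lambda>i. 1 / real (Suc i + d) - 1 / real (Suc (Suc i) + d)) sums (1 / real (Suc 0 + d) - 0)"
    by (rule telescope_sums')
  from sums_add[OF Suc.IH this] show ?case
    by (simp add: harm_pow_Suc algebra_simps)
qed

section \<open>Partial fractions of 1 / (x^n (x + d)^s)\<close>

text \<open>With u = 1/x and w = 1/d, this is the principal part at x = 0 of 1 / (x^n (x + d)^s):
  the binomial series of (x + d)^(-s), divided by x^n and cut off before the constant term. The pole
  at x = -d has principal part \<open>pfrac s n (- w) v\<close> with v = 1 / (x + d).\<close>

definition pfrac :: "nat \<Rightarrow> nat \<Rightarrow> real \<Rightarrow> real \<Rightarrow> real" where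
  "pfrac n s w u = (\<Sum>j<n. real ((s + j - 1) choose j) * (-1) ^ j * w ^ (s + j) * u ^ (n - j))"

text \<open>The same recursion that u v = w (u - v) induces on the monomials u^n v^s. On
  coefficients it is Pascal's rule.\<close>

lemma pfrac_Suc_Suc: "pfrac (Suc n) (Suc s) w u = w * (pfrac (Suc n) s w u - pfrac n (Suc s) w u)"
proof -
  have "pfrac (Suc n) (Suc s) w u =
      w ^ Suc s * u ^ Suc n + (\<Sum>j<n. real (Suc (s + j) choose Suc j) * (-1) ^ Suc j * w ^ (s + j + 2) * u ^ (n - j))"
    unfolding pfrac_def by (subst sum.lessThan_Suc_shift) simp
  moreover have "pfrac (Suc n) s w u =
      w ^ s * u ^ Suc n + (\<Sum>j<n. real ((s + j) choose Suc j) * (-1) ^ Suc j * w ^ (s + j + 1) * u ^ (n - j))"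
    unfolding pfrac_def by (subst sum.lessThan_Suc_shift) simp
  moreover have "pfrac n (Suc s) w u =
      (\<Sum>j<n. real ((s + j) choose j) * (-1) ^ j * w ^ (s + j + 1) * u ^ (n - j))"
    unfolding pfrac_def by simp
  ultimately show ?thesis
    by (simp add: sum_distrib_left sum_distrib_right sum_subtractf[symmetric] sum.distrib[symmetric] algebra_simps)
qed

lemma pfrac_exponent_0: "n > 0 \<Longrightarrow> pfrac n 0 w u = u ^ n"
proof -
  assume "n > 0"
  then obtain m where n: "n = Suc m" by (cases n) auto
  show ?thesis
    \<comment> \<open>Truncated subtraction makes the coefficient at j = 0 equal to 0 choose 0 = 1;
      for j > 0 it is (j - 1) choose j = 0.\<close>
    unfolding n pfrac_def by (subst sum.lessThan_Suc_shift) (simp add: binomial_eq_0)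
qed

lemma pfrac_order_0 [simp]: "pfrac 0 s w u = 0"
  by (simp add: pfrac_def)

text \<open>The hypothesis is \<open>1 / (x (x + d)) = (1 / d) (1 / x - 1 / (x + d))\<close> in terms of
  \<open>u = 1 / x\<close>, \<open>v = 1 / (x + d)\<close> and \<open>w = 1 / d\<close>.\<close>

lemma partial_fractions:
  fixes u v w :: real
  assumes uv: "u * v = w * (u - v)"
  shows "n + s > 0 \<Longrightarrow> u ^ n * v ^ s = pfrac n s w u + pfrac s n (- w) v"
proof (induction "n + s" arbitrary: n s rule: less_induct)
  case less
  show ?case
  proof (cases "n = 0 \<or> s = 0")
    case True
    then show ?thesis using less.prems by (auto simp: pfrac_exponent_0)
  next
    case False
    then obtain a b where ab: "n = Suc a" "s = Suc b"
      by (meson not0_implies_Suc)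
    \<comment> \<open>Trading one factor u v for w (u - v) lowers the total degree by one, so the
      induction hypothesis covers both resulting monomials.\<close>
    have "u ^ Suc a * v ^ Suc b = (u * v) * u ^ a * v ^ b"
      by simp
    also have "\<dots> = w * (u ^ Suc a * v ^ b - u ^ a * v ^ Suc b)"
      unfolding uv by (simp add: algebra_simps)
    also have "u ^ Suc a * v ^ b = pfrac (Suc a) b w u + pfrac b (Suc a) (- w) v"
      by (rule less.hyps) (simp_all add: ab)
    also have "u ^ a * v ^ Suc b = pfrac a (Suc b) w u + pfrac (Suc b) a (- w) v"
      by (rule less.hyps) (simp_all add: ab)
    finally show ?thesis
      unfolding ab pfrac_Suc_Suc by (simp add: algebra_simps)
  qed
qed

section \<open>The series of 1 / (i^n (i + d)^s)\<close>

text \<open>The principal part \<open>pfrac n s w u\<close> summed over u = 1/i, without its term of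
  exponent 1, whose series diverges.\<close>

definition zeta_part :: "nat \<Rightarrow> nat \<Rightarrow> real \<Rightarrow> real" where
  "zeta_part n s w = (\<Sum>j=0..n - 2. real ((s + j - 1) choose j) * (-1) ^ j * w ^ (s + j) * zeta (real (n - j)))"

text \<open>Collects the finite sums missing from the zeta tails at the pole -d, together with the
  harmonic number left by the two simple poles (j = s - 1).\<close>

definition harm_part :: "nat \<Rightarrow> nat \<Rightarrow> nat \<Rightarrow> real" where
  "harm_part n s d =
    (-1) ^ n * (\<Sum>j=0..s - 1. real ((n + j - 1) choose j) * harm_pow d (s - j) * (1 / real d ^ (n + j)))"

lemma pfrac_split_last:
  assumes "n \<ge> 2"
  shows "pfrac n s w u =
    (\<Sum>j=0..n - 2. real ((s + j - 1) choose j) * (-1) ^ j * w ^ (s + j) * u ^ (n - j))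
    + real ((n + s - 2) choose (n - 1)) * (-1) ^ (n - 1) * w ^ (n + s - 1) * u"
proof -
  obtain m where n: "n = Suc (Suc m)"
    using assms by (metis Suc_le_D numeral_2_eq_2 Suc_le_mono)
  have "{..<n} = insert (Suc m) {0..m}" by (auto simp: n)
  then show ?thesis
    unfolding pfrac_def by (simp add: n add_ac)
qed

text \<open>Explains why the signs do not alternate in j once w is replaced by -w: the two factors
  (-1)^j cancel.\<close>

lemma minus_one_power_cancel: "(-1) ^ j * (- w) ^ (n + j) = (-1) ^ n * (w :: real) ^ (n + j)"
  by (cases "even n"; cases "even j"; simp)

text \<open>Termwise summation of the partial fractions. Exponents at least 2 give zeta values at
  the pole 0 and zeta tails at the pole -d; the simple fractions have opposite coefficients and
  combine into \<open>reciprocal_diff_sums\<close>.\<close>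

lemma shifted_product_sums:
  assumes n: "n \<ge> 2" and s: "s \<ge> 2" and d: "d \<ge> 1"
  shows "(\<lambda>i. 1 / (real (Suc i) ^ n * real (Suc i + d) ^ s)) sums
    (zeta_part n s (1 / real d) + zeta_part s n (- 1 / real d) - harm_part n s d)"
proof -
  define w where "w = 1 / real d"
  let ?u = "\<lambda>i. 1 / real (Suc i)" and ?v = "\<lambda>i. 1 / real (Suc i + d)"
  let ?c = "real ((n + s - 2) choose (n - 1)) * (-1) ^ (n - 1) * w ^ (n + s - 1)"
  \<comment> \<open>The residues at the two poles are opposite: the binomials agree by symmetry, and
    the signs differ by one factor -1.\<close>
  have c': "real ((s + n - 2) choose (s - 1)) * (-1) ^ (s - 1) * (- w) ^ (s + n - 1) = - ?c"
  proof -
    have "(s + n - 2) choose (s - 1) = (n + s - 2) choose (n - 1)"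
      using binomial_symmetric[of "s - 1" "s + n - 2"] n s by (simp add: add.commute)
    moreover have "(-1) ^ (s - 1) * (- w) ^ (s + n - 1) = - ((-1) ^ (n - 1) * w ^ (n + s - 1))"
    proof -
      obtain a b where "n = Suc a" "s = Suc b"
        using n s by (metis Suc_le_D numeral_2_eq_2)
      then show ?thesis
        by (simp add: power_minus[of w] power_add add_ac)
    qed
    ultimately show ?thesis by (simp only: mult.assoc mult_minus_right)
  qed
  have eq: "1 / (real (Suc i) ^ n * real (Suc i + d) ^ s) =
      (\<Sum>j=0..n - 2. real ((s + j - 1) choose j) * (-1) ^ j * w ^ (s + j) * (1 / real (Suc i) ^ (n - j)))
    + (\<Sum>j=0..s - 2. real ((n + j - 1) choose j) * (-1) ^ j * (- w) ^ (n + j) * (1 / real (Suc i + d) ^ (s - j)))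
    + ?c * (1 / real (Suc i) - 1 / real (Suc i + d))" for i
  proof -
    have "?u i * ?v i = w * (?u i - ?v i)"
      using d by (simp add: w_def field_simps)
    then have "?u i ^ n * ?v i ^ s = pfrac n s w (?u i) + pfrac s n (- w) (?v i)"
      by (rule partial_fractions) (use n in simp)
    moreover have "?u i ^ n * ?v i ^ s = 1 / (real (Suc i) ^ n * real (Suc i + d) ^ s)"
      by (simp add: power_divide)
    ultimately show ?thesis
      unfolding pfrac_split_last[OF n] pfrac_split_last[OF s] c'
      by (simp add: power_one_over right_diff_distrib)
  qed
  have series: "(\<lambda>i. 1 / (real (Suc i) ^ n * real (Suc i + d) ^ s)) sums
      ((\<Sum>j=0..n - 2. real ((s + j - 1) choose j) * (-1) ^ j * w ^ (s + j) * zeta (real (n - j)))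
    + (\<Sum>j=0..s - 2. real ((n + j - 1) choose j) * (-1) ^ j * (- w) ^ (n + j) * (zeta (real (s - j)) - harm_pow d (s - j)))
    + ?c * harm_pow d 1)"
    unfolding eq
    by (intro sums_add sums_sum sums_mult zeta_sums zeta_tail_sums reciprocal_diff_sums)
       (use n s in auto)
  \<comment> \<open>Splitting off j = s - 1 separates the harmonic number of the simple poles from
    the corrections to the tails.\<close>
  have harm: "harm_part n s d =
      (\<Sum>j=0..s - 2. real ((n + j - 1) choose j) * (-1) ^ j * (- w) ^ (n + j) * harm_pow d (s - j))
      - ?c * harm_pow d 1"
  proof -
    obtain m where m: "s = Suc (Suc m)"
      using s by (metis Suc_le_D numeral_2_eq_2 Suc_le_mono)
    have sgn: "(-1) ^ j * (- w) ^ (n + j) = (-1) ^ n * w ^ (n + j)" for j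
      by (rule minus_one_power_cancel)
    have "harm_part n s d = (-1) ^ n *
        (\<Sum>j=0..Suc m. real ((n + j - 1) choose j) * harm_pow d (s - j) * w ^ (n + j))"
      by (simp add: harm_part_def m w_def power_one_over)
    also have "\<dots> = (\<Sum>j=0..m. real ((n + j - 1) choose j) * ((-1) ^ n * w ^ (n + j)) * harm_pow d (s - j))
        + (-1) ^ n * (real ((n + m) choose Suc m) * harm_pow d 1 * w ^ (n + Suc m))"
      by (simp add: m sum_distrib_left algebra_simps)
    also have "(-1) ^ n * (real ((n + m) choose Suc m) * harm_pow d 1 * w ^ (n + Suc m)) = - ?c * harm_pow d 1"
    proof -
      have "(n + m) choose Suc m = (n + m) choose (n - 1)"
        using binomial_symmetric[of "Suc m" "n + m"] n by simp
      moreover have "(-1) ^ n = - ((-1 :: real) ^ (n - 1))"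
        using n by (cases n) auto
      ultimately show ?thesis by (simp add: m)
    qed
    finally show ?thesis unfolding sgn[symmetric] by (simp add: m mult.assoc)
  qed
  have w: "1 / real d = w" "- 1 / real d = - w"
    by (simp_all add: w_def)
  show ?thesis
    using series unfolding harm w zeta_part_def
    by (simp add: right_diff_distrib sum_subtractf algebra_simps)
qed

section \<open>The two series: convergence, value at shift 1, and change under a shift\<close>

definition euler_term :: "nat \<Rightarrow> nat \<Rightarrow> nat \<Rightarrow> nat \<Rightarrow> real" where
  "euler_term n s \<mu> \<nu> = harm_pow (Suc \<nu>) n / real (Suc \<nu> + \<mu>) ^ s"

text \<open>The numerators are bounded by a zeta value, so a multiple of a zeta tail
  dominates.\<close>

lemma summable_euler_term:
  assumes "n \<ge> 2" "s \<ge> 2"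
  shows "summable (euler_term n s \<mu>)"
proof (rule summable_comparison_test')
  show "summable (\<lambda>\<nu>. zeta (real n) * (1 / real (Suc \<nu> + \<mu>) ^ s))"
    by (intro summable_mult sums_summable[OF zeta_tail_sums] assms)
  show "norm (euler_term n s \<mu> \<nu>) \<le> zeta (real n) * (1 / real (Suc \<nu> + \<mu>) ^ s)" for \<nu>
    using harm_pow_le_zeta[OF assms(1), of "Suc \<nu>"] harm_pow_nonneg[of "Suc \<nu>" n]
    by (simp add: euler_term_def divide_right_mono)
qed

text \<open>The increments of \<open>harm_pow m n * harm_pow m s\<close> are the two desired terms
  plus the diagonal term 1 / (m + 1)^(n + s), and they telescope to the product of the zeta
  values.\<close>

lemma suminf_euler_term_1:
  assumes n: "n \<ge> 2" and s: "s \<ge> 2"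
  shows "(\<Sum>\<nu>. euler_term n s 1 \<nu>) + (\<Sum>\<nu>. euler_term s n 1 \<nu>) =
    zeta (real n) * zeta (real s) - zeta (real (n + s))"
proof -
  let ?p = "\<lambda>m. harm_pow m n * harm_pow m s"
  have "?p \<longlonglongrightarrow> zeta (real n) * zeta (real s)"
    by (intro tendsto_mult harm_pow_tendsto_zeta n s)
  then have "(\<lambda>m. ?p (Suc m) - ?p m) sums (zeta (real n) * zeta (real s) - ?p 0)"
    by (rule telescope_sums)
  moreover have "(\<lambda>m. 1 / real (Suc m) ^ (n + s)) sums zeta (real (n + s))"
    by (rule zeta_sums) (use n in simp)
  ultimately have "(\<lambda>m. ?p (Suc m) - ?p m - 1 / real (Suc m) ^ (n + s)) sums
      (zeta (real n) * zeta (real s) - zeta (real (n + s)))"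
    using sums_diff by fastforce
  moreover have "?p (Suc m) - ?p m - 1 / real (Suc m) ^ (n + s) =
      harm_pow m n / real (Suc m) ^ s + harm_pow m s / real (Suc m) ^ n" for m
    unfolding harm_pow_Suc by (simp add: power_add algebra_simps)
  ultimately have "(\<lambda>m. harm_pow m n / real (Suc m) ^ s + harm_pow m s / real (Suc m) ^ n) sums
      (zeta (real n) * zeta (real s) - zeta (real (n + s)))"
    by simp
  \<comment> \<open>The term at m = 0 vanishes because \<open>harm_pow 0\<close> is 0; dropping it
    moves the index to \<open>Suc m\<close> and produces the shift 1.\<close>
  then have "(\<lambda>m. euler_term n s 1 m + euler_term s n 1 m) sums
      (zeta (real n) * zeta (real s) - zeta (real (n + s)))"
    using sums_Suc_iff[of "\<lambda>m. harm_pow m n / real (Suc m) ^ s + harm_pow m s / real (Suc m) ^ n"]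
    by (simp add: euler_term_def add_ac)
  then show ?thesis
    using suminf_add[OF summable_euler_term[OF n s] summable_euler_term[OF s n]]
    by (simp add: sums_iff)
qed

lemma suminf_euler_term_Suc:
  assumes n: "n \<ge> 2" and s: "s \<ge> 2"
  shows "(\<Sum>\<nu>. euler_term n s (Suc \<mu>) \<nu>) =
    (\<Sum>\<nu>. euler_term n s \<mu> \<nu>) - (\<Sum>i. 1 / (real (Suc i) ^ n * real (Suc i + \<mu>) ^ s))"
proof -
  let ?f = "\<lambda>m. harm_pow m n / real (Suc m + \<mu>) ^ s"
  have "euler_term n s (Suc \<mu>) sums (\<Sum>\<nu>. euler_term n s (Suc \<mu>) \<nu>)"
    using summable_euler_term[OF n s] by (rule summable_sums)
  moreover have "euler_term n s (Suc \<mu>) = (\<lambda>\<nu>. ?f (Suc \<nu>))"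
    by (simp add: euler_term_def fun_eq_iff)
  \<comment> \<open>\<open>?f 0 = 0\<close>, so starting one index earlier leaves the sum unchanged.
    Now both series have the same denominators, and their numerators differ by 1 / (m +
    1)^n.\<close>
  ultimately have "?f sums (\<Sum>\<nu>. euler_term n s (Suc \<mu>) \<nu>)"
    using sums_Suc[of ?f] by simp
  from sums_diff[OF summable_sums[OF summable_euler_term[OF n s, of \<mu>]] this]
  have "(\<lambda>m. 1 / (real (Suc m) ^ n * real (Suc m + \<mu>) ^ s)) sums
      ((\<Sum>\<nu>. euler_term n s \<mu> \<nu>) - (\<Sum>\<nu>. euler_term n s (Suc \<mu>) \<nu>))"
    unfolding euler_term_def[of n s \<mu>] by (simp add: harm_pow_Suc add_divide_distrib)
  then show ?thesis by (simp add: sums_iff)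
qed

lemma suminf_euler_term_symmetric:
  assumes n: "n \<ge> 2" and s: "s \<ge> 2"
  shows "(\<Sum>\<nu>. euler_term n s (Suc m) \<nu>) + (\<Sum>\<nu>. euler_term s n (Suc m) \<nu>) =
    zeta (real n) * zeta (real s) - zeta (real (n + s))
    - (\<Sum>d=1..m. zeta_part n s (1 / real d) + zeta_part s n (- 1 / real d))
    - (\<Sum>d=1..m. zeta_part s n (1 / real d) + zeta_part n s (- 1 / real d))
    + (\<Sum>d=1..m. harm_part n s d) + (\<Sum>d=1..m. harm_part s n d)"
proof (induction m)
  case 0
  then show ?case using suminf_euler_term_1[OF n s] by simp
next
  case (Suc m)
  have "(\<Sum>i. 1 / (real (Suc i) ^ n * real (Suc i + Suc m) ^ s)) =
      zeta_part n s (1 / real (Suc m)) + zeta_part s n (- 1 / real (Suc m)) - harm_part n s (Suc m)"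
    by (rule sums_unique[symmetric], rule shifted_product_sums[OF n s]) simp
  moreover have "(\<Sum>i. 1 / (real (Suc i) ^ s * real (Suc i + Suc m) ^ n)) =
      zeta_part s n (1 / real (Suc m)) + zeta_part n s (- 1 / real (Suc m)) - harm_part s n (Suc m)"
    by (rule sums_unique[symmetric], rule shifted_product_sums[OF s n]) simp
  ultimately show ?case
    using Suc.IH unfolding suminf_euler_term_Suc[OF n s, of "Suc m"] suminf_euler_term_Suc[OF s n, of "Suc m"]
    by simp
qed

section \<open>Summation over the shifts d\<close>

text \<open>The argument 1/d contributes the sign (-1)^j and the argument -1/d the sign (-1)^j
  (-1)^(s + j) = (-1)^s. Summing the powers of 1/d then gives
  \<open>harm_pow m (s + j)\<close>.\<close>

lemma sum_zeta_part:
  "(\<Sum>d=1..m. zeta_part n s (1 / real d) + zeta_part n s (- 1 / real d)) =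
    (\<Sum>j=0..n - 2. real ((s + j - 1) choose j) * ((-1) ^ j + (-1) ^ s) * zeta (real (n - j)) * harm_pow m (s + j))"
proof -
  have "zeta_part n s (1 / real d) + zeta_part n s (- 1 / real d) =
    (\<Sum>j=0..n - 2. real ((s + j - 1) choose j) * ((-1) ^ j + (-1) ^ s) * zeta (real (n - j)) * (1 / real d ^ (s + j)))" for d
  proof -
    have "c * (-1) ^ j * (1 / real d) ^ (s + j) * z + c * (-1) ^ j * (- 1 / real d) ^ (s + j) * z =
        c * ((-1) ^ j + (-1) ^ s) * z * (1 / real d ^ (s + j))" for c z j
    proof -
      have "(-1) ^ j * (- 1 / real d) ^ (s + j) = (-1) ^ s * (1 / real d ^ (s + j))"
        using minus_one_power_cancel[of j "1 / real d" s] by (simp add: power_one_over)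
      then have "c * (-1) ^ j * (- 1 / real d) ^ (s + j) * z = c * ((-1) ^ s * (1 / real d ^ (s + j))) * z"
        by (simp only: mult.assoc)
      then show ?thesis
        by (simp add: power_one_over distrib_left distrib_right add_divide_distrib)
    qed
    then show ?thesis
      unfolding zeta_part_def sum.distrib[symmetric] by (intro sum.cong refl)
  qed
  then show ?thesis
    unfolding harm_pow_def by (simp only: sum_distrib_left) (rule sum.swap)
qed

text \<open>Summation by parts. The product runs over all pairs i \<le> m + 1, d \<le> m of terms 1
  / (i^a d^b); the left side keeps i \<le> d, and the subtracted sum is the rest, d \<le> i - 1. The
  bound m + 1 is the \<mu> of the final formula.\<close>

lemma sum_harm_pow_mult:
  "(\<Sum>d=1..m. harm_pow d a * (1 / real d ^ b)) =
    harm_pow (Suc m) a * harm_pow m b - (\<Sum>i=1..Suc m. harm_pow (i - 1) b / real i ^ a)"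
proof (induction m)
  case (Suc m)
  have "harm_pow (Suc (Suc m)) a * harm_pow (Suc m) b =
      harm_pow (Suc m) a * harm_pow m b + harm_pow (Suc m) a * (1 / real (Suc m) ^ b)
      + harm_pow (Suc m) b / real (Suc (Suc m)) ^ a"
    unfolding harm_pow_Suc[of "Suc m" a] harm_pow_Suc[of m b]
    by (simp add: algebra_simps add_divide_distrib)
  moreover have "(\<Sum>i=1..Suc (Suc m). harm_pow (i - 1) b / real i ^ a) =
      (\<Sum>i=1..Suc m. harm_pow (i - 1) b / real i ^ a) + harm_pow (Suc m) b / real (Suc (Suc m)) ^ a"
    by simp
  moreover have "(\<Sum>d=1..Suc m. harm_pow d a * (1 / real d ^ b)) =
      (\<Sum>d=1..m. harm_pow d a * (1 / real d ^ b)) + harm_pow (Suc m) a * (1 / real (Suc m) ^ b)"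
    by simp
  ultimately show ?case using Suc.IH by linarith
qed simp

text \<open>The square of index pairs splits into its diagonal and two open triangles.\<close>

lemma harm_pow_mult:
  "harm_pow m a * harm_pow m b = harm_pow m (a + b)
    + (\<Sum>i=1..m. harm_pow (i - 1) a / real i ^ b) + (\<Sum>i=1..m. harm_pow (i - 1) b / real i ^ a)"
  by (induction m) (simp_all add: harm_pow_Suc power_add algebra_simps)

section \<open>Binomial identities that collapse the double sums\<close>

text \<open>Compares coefficients of x^(n - 1) in (1+x)^(-s) (1+x)^(n+s-k-1) = (1+x)^(n-k-1).
  Negating the upper index turns (n - k - 1) choose (n - 1) into a signed (k - 1) choose (n -
  1).\<close>

lemma alternating_binomial_convolution:
  fixes n s k :: nat
  assumes "n \<ge> 1" "s \<ge> 1" "k \<ge> 1" "k < n + s"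
  shows "(\<Sum>j=0..n - 1. real ((s + j - 1) choose j) * (-1) ^ j * real ((n + s - k - 1) choose (n - j - 1)))
    = - ((-1) ^ n) * real ((k - 1) choose (n - 1))"
proof -
  define K where "K = n + s - k - 1"
  have "(\<Sum>j=0..n - 1. real ((s + j - 1) choose j) * (-1) ^ j * real (K choose (n - j - 1)))
      = (\<Sum>j=0..n - 1. ((- real s) gchoose j) * (real K gchoose (n - 1 - j)))"
  proof (intro sum.cong refl)
    fix j assume "j \<in> {0..n - 1}"
    have "real j - (- real s) - 1 = real (s + j - 1)" using assms by (simp add: of_nat_diff)
    then have "(- real s) gchoose j = (-1) ^ j * real ((s + j - 1) choose j)"
      by (simp only: gbinomial_negated_upper[of "- real s"] binomial_gbinomial)
    then show "real ((s + j - 1) choose j) * (-1) ^ j * real (K choose (n - j - 1)) =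
        ((- real s) gchoose j) * (real K gchoose (n - 1 - j))"
      by (simp add: binomial_gbinomial diff_commute)
  qed
  also have "\<dots> = (- real s + real K) gchoose (n - 1)"
    by (rule gbinomial_Vandermonde)
  also have "\<dots> = (-1) ^ (n - 1) * real ((k - 1) choose (n - 1))"
  proof -
    have "real (n - 1) - (- real s + real K) - 1 = real (k - 1)"
      using assms by (simp add: K_def of_nat_diff)
    then show ?thesis
      by (simp only: gbinomial_negated_upper[of "- real s + real K"] binomial_gbinomial)
  qed
  also have "(-1) ^ (n - 1) = - ((-1 :: real) ^ n)"
    using assms by (cases n) auto
  finally show ?thesis unfolding K_def .
qed

text \<open>For k \<le> n the product of binomials factors as (K choose (s - 1)) ((n - k) choose j)
  with K = n + s - k - 1, which leaves an alternating row sum of Pascal's triangle, zero unless n =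
  k. For k > n every second binomial is zero.\<close>

lemma alternating_trinomial_sum:
  fixes n s k :: nat
  assumes "n \<ge> 1" "s \<ge> 1" "k \<ge> 1" "k < n + s"
  shows "(\<Sum>j=0..n - 1. real ((s + j - 1) choose j) * (-1) ^ j * real ((n + s - k - 1) choose (s + j - 1)))
    = (if k = n then 1 else 0)"
proof (cases "k \<le> n")
  case True
  define K where "K = n + s - k - 1"
  have K: "K - (s - 1) = n - k" "s - 1 \<le> K" using assms True by (auto simp: K_def)
  have "(\<Sum>j=0..n - 1. real ((s + j - 1) choose j) * (-1) ^ j * real (K choose (s + j - 1)))
      = (\<Sum>j=0..n - 1. real (K choose (s - 1)) * ((-1) ^ j * real ((n - k) choose j)))"
  proof (intro sum.cong refl)
    fix j
    have "(K choose (s + j - 1)) * ((s + j - 1) choose j) = (K choose (s - 1)) * ((n - k) choose j)"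
    proof (cases "s + j - 1 \<le> K")
      case le: True
      have "(s + j - 1) choose j = (s + j - 1) choose (s - 1)"
        using binomial_symmetric[of j "s + j - 1"] assms by simp
      then show ?thesis
        using choose_mult[of "s - 1" "s + j - 1" K] le K assms by simp
    next
      case False
      then show ?thesis using K by (simp add: binomial_eq_0)
    qed
    then have "real (K choose (s + j - 1)) * real ((s + j - 1) choose j)
        = real (K choose (s - 1)) * real ((n - k) choose j)"
      by (metis of_nat_mult)
    then show "real ((s + j - 1) choose j) * (-1) ^ j * real (K choose (s + j - 1)) =
        real (K choose (s - 1)) * ((-1) ^ j * real ((n - k) choose j))"
      by (simp add: mult_ac)
  qed
  also have "\<dots> = real (K choose (s - 1)) * (\<Sum>j=0..n - 1. (-1) ^ j * real ((n - k) choose j))"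
    by (simp add: sum_distrib_left)
  also have "(\<Sum>j=0..n - 1. (-1) ^ j * real ((n - k) choose j)) = (\<Sum>j\<le>n - k. (-1) ^ j * real ((n - k) choose j))"
    by (rule sum.mono_neutral_right) (use assms in \<open>auto simp: binomial_eq_0\<close>)
  also have "\<dots> = (if k = n then 1 else 0)"
    using choose_alternating_sum[of "n - k", where ?'a = real] True by (cases "k = n") auto
  \<comment> \<open>At k = n the row index K equals s - 1, so the prefactor is 1.\<close>
  also have "real (K choose (s - 1)) * (if k = n then 1 else 0) = (if k = n then 1 else 0)"
    using assms by (simp add: K_def)
  finally show ?thesis unfolding K_def .
next
  case False
  then show ?thesis using assms by (simp add: binomial_eq_0)
qed

text \<open>Once the inner range no longer depends on j, the sums can be exchanged and
  \<open>alternating_binomial_convolution\<close> evaluates the sum over j.\<close>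

lemma collapse_convolution_sum:
  fixes x :: "nat \<Rightarrow> real"
  assumes "n \<ge> 1" "s \<ge> 1"
  shows "(\<Sum>j=0..n - 1. real ((s + j - 1) choose j) * (-1) ^ j *
      (\<Sum>k=1..s + j. real ((n + s - k - 1) choose (n - j - 1)) * x k))
    = - ((-1) ^ n) * (\<Sum>j=0..s - 1. real ((n + j - 1) choose j) * x (n + j))"
proof -
  let ?I = "{1..n + s - 1}"
  have "(\<Sum>k=1..s + j. real ((n + s - k - 1) choose (n - j - 1)) * x k)
      = (\<Sum>k\<in>?I. real ((n + s - k - 1) choose (n - j - 1)) * x k)" if "j \<in> {0..n - 1}" for j
    \<comment> \<open>For k > s + j the upper index n + s - k - 1 lies below n - j - 1, so the added
      terms are zero.\<close>
    by (rule sum.mono_neutral_left) (use that assms in \<open>auto simp: binomial_eq_0\<close>)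
  then have "(\<Sum>j=0..n - 1. real ((s + j - 1) choose j) * (-1) ^ j *
      (\<Sum>k=1..s + j. real ((n + s - k - 1) choose (n - j - 1)) * x k))
    = (\<Sum>j=0..n - 1. \<Sum>k\<in>?I. real ((s + j - 1) choose j) * (-1) ^ j *
      real ((n + s - k - 1) choose (n - j - 1)) * x k)"
    by (simp add: sum_distrib_left mult.assoc)
  also have "\<dots> = (\<Sum>k\<in>?I. (\<Sum>j=0..n - 1. real ((s + j - 1) choose j) * (-1) ^ j *
      real ((n + s - k - 1) choose (n - j - 1))) * x k)"
    by (subst sum.swap) (simp add: sum_distrib_right)
  also have "\<dots> = (\<Sum>k\<in>?I. - ((-1) ^ n) * (real ((k - 1) choose (n - 1)) * x k))"
    using assms by (intro sum.cong refl) (subst alternating_binomial_convolution, auto)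
  also have "\<dots> = - ((-1) ^ n) * (\<Sum>k\<in>?I. real ((k - 1) choose (n - 1)) * x k)"
    by (simp only: sum_distrib_left)
  also have "(\<Sum>k\<in>?I. real ((k - 1) choose (n - 1)) * x k)
      = (\<Sum>k\<in>{n..n + s - 1}. real ((k - 1) choose (n - 1)) * x k)"
    by (rule sum.mono_neutral_right) (use assms in \<open>auto simp: binomial_eq_0\<close>)
  also have "\<dots> = (\<Sum>j=0..s - 1. real ((n + j - 1) choose j) * x (n + j))"
  proof (rule sum.reindex_bij_witness[where i = "\<lambda>j. n + j" and j = "\<lambda>k. k - n"])
    fix k assume k: "k \<in> {n..n + s - 1}"
    then have "(k - 1) choose (k - n) = (k - 1) choose (n - 1)"
      using binomial_symmetric[of "n - 1" "k - 1"] assms by auto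
    with k show "real ((n + (k - n) - 1) choose (k - n)) * x (n + (k - n)) = real ((k - 1) choose (n - 1)) * x k"
      by simp
  qed (use assms in auto)
  finally show ?thesis .
qed

text \<open>The same exchange of summations; \<open>alternating_trinomial_sum\<close> leaves only k
  = n.\<close>

lemma collapse_trinomial_sum:
  fixes x :: "nat \<Rightarrow> real"
  assumes "n \<ge> 1" "s \<ge> 1"
  shows "(\<Sum>j=0..n - 1. real ((s + j - 1) choose j) * (-1) ^ j *
      (\<Sum>k=1..n - j. real ((n + s - k - 1) choose (s + j - 1)) * x k)) = x n"
proof -
  let ?I = "{1..n + s - 1}"
  have "(\<Sum>k=1..n - j. real ((n + s - k - 1) choose (s + j - 1)) * x k)
      = (\<Sum>k\<in>?I. real ((n + s - k - 1) choose (s + j - 1)) * x k)" if "j \<in> {0..n - 1}" for j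
    by (rule sum.mono_neutral_left) (use that assms in \<open>auto simp: binomial_eq_0\<close>)
  then have "(\<Sum>j=0..n - 1. real ((s + j - 1) choose j) * (-1) ^ j *
      (\<Sum>k=1..n - j. real ((n + s - k - 1) choose (s + j - 1)) * x k))
    = (\<Sum>j=0..n - 1. \<Sum>k\<in>?I. real ((s + j - 1) choose j) * (-1) ^ j *
      real ((n + s - k - 1) choose (s + j - 1)) * x k)"
    by (simp add: sum_distrib_left mult.assoc)
  also have "\<dots> = (\<Sum>k\<in>?I. (\<Sum>j=0..n - 1. real ((s + j - 1) choose j) * (-1) ^ j *
      real ((n + s - k - 1) choose (s + j - 1))) * x k)"
    by (subst sum.swap) (simp add: sum_distrib_right)
  also have "\<dots> = (\<Sum>k\<in>?I. if k = n then x k else 0)"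
    using assms by (intro sum.cong refl) (subst alternating_trinomial_sum, auto)
  also have "\<dots> = x n"
    using assms by (auto simp: sum.delta)
  finally show ?thesis .
qed

section \<open>Assembly of the general formula\<close>

text \<open>Summation by parts yields the products and a single sum of corrections;
  \<open>collapse_convolution_sum\<close>, read from right to left, expands the latter into the
  double sum of the stated formula.\<close>

lemma sum_harm_part:
  assumes "n \<ge> 1" "s \<ge> 1"
  shows "(\<Sum>d=1..m. harm_part n s d) =
    (-1) ^ n * (\<Sum>j=0..s - 1. real ((n + j - 1) choose j) * harm_pow (Suc m) (s - j) * harm_pow m (n + j))
    + (\<Sum>j=0..n - 1. real ((s + j - 1) choose j) * (-1) ^ j *
        (\<Sum>k=1..s + j. real ((n + s - k - 1) choose (n - j - 1)) *
          (\<Sum>i=1..Suc m. harm_pow (i - 1) k / real i ^ (n + s - k))))"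
proof -
  have "(\<Sum>d=1..m. harm_part n s d) =
      (-1) ^ n * (\<Sum>j=0..s - 1. real ((n + j - 1) choose j) * (\<Sum>d=1..m. harm_pow d (s - j) * (1 / real d ^ (n + j))))"
    unfolding harm_part_def sum_distrib_left[symmetric]
    by (subst sum.swap) (simp only: sum_distrib_left mult.assoc)
  \<comment> \<open>The exponent s - j is written as n + s - (n + j) so that the correction depends
    on j only through n + j.\<close>
  also have "\<dots> = (-1) ^ n * (\<Sum>j=0..s - 1. real ((n + j - 1) choose j) * harm_pow (Suc m) (s - j) * harm_pow m (n + j))
      - (-1) ^ n * (\<Sum>j=0..s - 1. real ((n + j - 1) choose j) * (\<Sum>i=1..Suc m. harm_pow (i - 1) (n + j) / real i ^ (n + s - (n + j))))"
    unfolding sum_harm_pow_mult by (simp add: right_diff_distrib sum_subtractf mult.assoc)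
  finally show ?thesis
    unfolding collapse_convolution_sum[OF assms] by simp
qed

text \<open>The last two double sums are just \<open>T n\<close> and \<open>T s\<close>. They cancel
  against \<open>harm_pow \<mu> (n + s) - harm_pow \<mu> n * harm_pow \<mu> s\<close>, which equals
  - \<open>T n\<close> - \<open>T s\<close> by \<open>harm_pow_mult\<close>.\<close>

lemma suminf_euler_term_formula:
  assumes "\<mu> \<ge> 1" and n: "n \<ge> 2" and s: "s \<ge> 2"
  defines "T \<equiv> \<lambda>k. \<Sum>i=1..\<mu>. harm_pow (i - 1) k / real i ^ (n + s - k)"
  shows "(\<Sum>\<nu>. euler_term n s \<mu> \<nu>) + (\<Sum>\<nu>. euler_term s n \<mu> \<nu>) =
      harm_pow \<mu> (n + s) - harm_pow \<mu> n * harm_pow \<mu> s - zeta (real (n + s)) + zeta (real n) * zeta (real s)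
      - (\<Sum>j=0..n - 2. real ((s + j - 1) choose j) * ((-1) ^ j + (-1) ^ s) * zeta (real (n - j)) * harm_pow (\<mu> - 1) (s + j))
      - (\<Sum>j=0..s - 2. real ((n + j - 1) choose j) * ((-1) ^ j + (-1) ^ n) * zeta (real (s - j)) * harm_pow (\<mu> - 1) (n + j))
      + (-1) ^ n * (\<Sum>j=0..s - 1. real ((n + j - 1) choose j) * harm_pow \<mu> (s - j) * harm_pow (\<mu> - 1) (n + j))
      + (-1) ^ s * (\<Sum>j=0..n - 1. real ((s + j - 1) choose j) * harm_pow \<mu> (n - j) * harm_pow (\<mu> - 1) (s + j))
      + (\<Sum>j=0..n - 1. real ((s + j - 1) choose j) * (-1) ^ j * (\<Sum>k=1..s + j. real ((n + s - k - 1) choose (n - j - 1)) * T k))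
      + (\<Sum>j=0..s - 1. real ((n + j - 1) choose j) * (-1) ^ j * (\<Sum>k=1..n + j. real ((n + s - k - 1) choose (s - j - 1)) * T k))
      + (\<Sum>j=0..n - 1. real ((s + j - 1) choose j) * (-1) ^ j * (\<Sum>k=1..n - j. real ((n + s - k - 1) choose (s + j - 1)) * T k))
      + (\<Sum>j=0..s - 1. real ((n + j - 1) choose j) * (-1) ^ j * (\<Sum>k=1..s - j. real ((n + s - k - 1) choose (n + j - 1)) * T k))"
proof -
  obtain m where \<mu>: "\<mu> = Suc m" using assms(1) by (cases \<mu>) auto
  then have m: "\<mu> - 1 = m" by simp
  have pos: "n \<ge> 1" "s \<ge> 1" using n s by auto
  have T: "(\<Sum>i=1..\<mu>. harm_pow (i - 1) k / real i ^ (n + s - k)) = T k" for k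
    by (simp add: T_def)
  \<comment> \<open>Regroups so that each zeta part meets its own value at the opposite argument, as
    \<open>sum_zeta_part\<close> requires.\<close>
  have zeta_sum: "(\<Sum>d=1..m. zeta_part n s (1 / real d) + zeta_part s n (- 1 / real d))
      + (\<Sum>d=1..m. zeta_part s n (1 / real d) + zeta_part n s (- 1 / real d)) =
      (\<Sum>d=1..m. zeta_part n s (1 / real d) + zeta_part n s (- 1 / real d))
      + (\<Sum>d=1..m. zeta_part s n (1 / real d) + zeta_part s n (- 1 / real d))"
    by (simp only: sum.distrib)
  have harm_sum: "(\<Sum>d=1..m. harm_part s n d) =
      (-1) ^ s * (\<Sum>j=0..n - 1. real ((s + j - 1) choose j) * harm_pow \<mu> (n - j) * harm_pow m (s + j))
      + (\<Sum>j=0..s - 1. real ((n + j - 1) choose j) * (-1) ^ j *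
        (\<Sum>k=1..n + j. real ((n + s - k - 1) choose (s - j - 1)) * T k))"
    using sum_harm_part[OF pos(2,1), of m] by (simp only: T_def \<mu> add.commute[of s n])
  have product: "harm_pow \<mu> n * harm_pow \<mu> s = harm_pow \<mu> (n + s) + T n + T s"
    unfolding harm_pow_mult by (simp add: T_def)
  have B: "(\<Sum>j=0..n - 1. real ((s + j - 1) choose j) * (-1) ^ j * (\<Sum>k=1..n - j. real ((n + s - k - 1) choose (s + j - 1)) * T k)) = T n"
    "(\<Sum>j=0..s - 1. real ((n + j - 1) choose j) * (-1) ^ j * (\<Sum>k=1..s - j. real ((n + s - k - 1) choose (n + j - 1)) * T k)) = T s"
    using collapse_trinomial_sum[OF pos, of T] collapse_trinomial_sum[OF pos(2,1), of T]
    by (simp_all only: add.commute[of s n])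
  have combine: "L = h - q - z + z2 - Z1 - Z2 + P1 + P2 + A1 + A2 + t1 + t2"
    if "L = z2 - z - U - V + (P1 + A1) + (P2 + A2)" "U + V = Z1 + Z2" "q = h + t1 + t2"
    for L h q z z2 Z1 Z2 P1 P2 A1 A2 t1 t2 U V :: real
    using that by linarith
  show ?thesis
    using suminf_euler_term_symmetric[OF n s, of m] zeta_sum product
    unfolding B harm_sum sum_zeta_part sum_harm_part[OF pos] \<mu>[symmetric] T m
    by (rule combine)
qed

section \<open>The case n = s\<close>

text \<open>For s = n the sums of the general formula coincide in pairs, and j is replaced by n - j.
  The sum of products has the uniform sign (-1)^n in the general formula, so here it carries no
  factor (-1)^j, unlike in the opening display.\<close>

lemma suminf_euler_term_diagonal:
  assumes "\<mu> \<ge> 1" and n: "n \<ge> 2"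
  defines "T \<equiv> \<lambda>k. \<Sum>i=1..\<mu>. harm_pow (i - 1) k / real i ^ (2 * n - k)"
  shows "2 * (\<Sum>\<nu>. euler_term n n \<mu> \<nu>) =
      harm_pow \<mu> (2 * n) - zeta (real (2 * n)) - (harm_pow \<mu> n)\<^sup>2 + (zeta (real n))\<^sup>2
      + (-1) ^ (n - 1) * 4 * (\<Sum>j=1..n div 2. real ((2 * n - 2 * j - 1) choose (n - 1)) * zeta (real (2 * j)) * harm_pow (\<mu> - 1) (2 * n - 2 * j))
      - (-1) ^ (n - 1) * 2 * (\<Sum>j=1..n. real ((2 * n - j - 1) choose (n - 1)) * harm_pow (\<mu> - 1) (2 * n - j) * harm_pow \<mu> j)
      - (-1) ^ (n - 1) * 2 * (\<Sum>j=1..n. real ((2 * n - j - 1) choose (n - 1)) * (-1) ^ j * (\<Sum>k=1..2 * n - j. real ((2 * n - k - 1) choose (j - 1)) * T k))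
      - (-1) ^ (n - 1) * 2 * (\<Sum>j=1..n. real ((2 * n - j - 1) choose (n - 1)) * (-1) ^ j * (\<Sum>k=1..j. real ((2 * n - k - 1) choose (2 * n - j - 1)) * T k))"
proof -
  have T: "(\<Sum>i=1..\<mu>. harm_pow (i - 1) k / real i ^ (2 * n - k)) = T k" for k
    by (simp add: T_def)
  have sgn: "(-1) ^ (n - 1) = - ((-1 :: real) ^ n)"
    using n by (cases n) auto
  have choose: "(2 * n - j - 1) choose (n - j) = (2 * n - j - 1) choose (n - 1)" if "1 \<le> j" "j \<le> n" for j
    using binomial_symmetric[of "n - j" "2 * n - j - 1"] that by (simp add: mult_2)
  have sgn_diff: "(-1) ^ (n - j) = (-1) ^ n * (-1 :: real) ^ j" if "j \<le> n" for j
    using that by (auto simp: minus_one_power_iff)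
  have reflect: "(\<Sum>j=0..n - 1. f j) = (\<Sum>j=1..n. f (n - j))" for f :: "nat \<Rightarrow> real"
    by (rule sum.reindex_bij_witness[where i = "\<lambda>j. n - j" and j = "\<lambda>j. n - j"]) (use n in auto)
  have reflect2: "(\<Sum>j=0..n - 2. f j) = (\<Sum>j=2..n. f (n - j))" for f :: "nat \<Rightarrow> real"
    by (rule sum.reindex_bij_witness[where i = "\<lambda>j. n - j" and j = "\<lambda>j. n - j"]) (use n in auto)
  \<comment> \<open>After reflection the sign factor is (-1)^n (1 + (-1)^j): odd j drop out and even
    j count twice. The two equal zeta sums then give the coefficient 4.\<close>
  have Z: "(\<Sum>j=0..n - 2. real ((n + j - 1) choose j) * ((-1) ^ j + (-1) ^ n) * zeta (real (n - j)) * harm_pow (\<mu> - 1) (n + j))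
    = (-1) ^ n * 2 * (\<Sum>j=1..n div 2. real ((2 * n - 2 * j - 1) choose (n - 1)) * zeta (real (2 * j)) * harm_pow (\<mu> - 1) (2 * n - 2 * j))"
    (is "?l = ?r")
  proof -
    let ?g = "\<lambda>j. real ((2 * n - j - 1) choose (n - 1)) * zeta (real j) * harm_pow (\<mu> - 1) (2 * n - j)"
    have "?l = (\<Sum>j=2..n. (-1) ^ n * (if even j then 2 * ?g j else 0))"
      unfolding reflect2
    proof (intro sum.cong refl)
      fix j assume "j \<in> {2..n}"
      then have j: "1 \<le> j" "j \<le> n" "n - (n - j) = j" "n + (n - j) = 2 * n - j" by auto
      show "real ((n + (n - j) - 1) choose (n - j)) * ((-1) ^ (n - j) + (-1) ^ n) * zeta (real (n - (n - j))) * harm_pow (\<mu> - 1) (n + (n - j))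
        = (-1) ^ n * (if even j then 2 * ?g j else 0)"
        unfolding choose[OF j(1,2)] sgn_diff[OF j(2)] j(3,4) by simp
    qed
    also have "\<dots> = (-1) ^ n * (\<Sum>j=2..n. if even j then 2 * ?g j else 0)"
      by (rule sum_distrib_left[symmetric])
    also have "(\<Sum>j=2..n. if even j then 2 * ?g j else 0) = (\<Sum>j\<in>{j\<in>{2..n}. even j}. 2 * ?g j)"
      by (rule sum.inter_filter[symmetric]) simp
    also have "\<dots> = (\<Sum>j=1..n div 2. 2 * ?g (2 * j))"
      by (rule sum.reindex_bij_witness[where i = "\<lambda>j. 2 * j" and j = "\<lambda>j. j div 2"]) auto
    finally show ?thesis by (simp only: sum_distrib_left[symmetric] mult.assoc)
  qed
  have P: "(\<Sum>j=0..n - 1. real ((n + j - 1) choose j) * harm_pow \<mu> (n - j) * harm_pow (\<mu> - 1) (n + j))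
    = (\<Sum>j=1..n. real ((2 * n - j - 1) choose (n - 1)) * harm_pow (\<mu> - 1) (2 * n - j) * harm_pow \<mu> j)"
    unfolding reflect
  proof (intro sum.cong refl)
    fix j assume "j \<in> {1..n}"
    then have j: "1 \<le> j" "j \<le> n" "n - (n - j) = j" "n + (n - j) = 2 * n - j" by auto
    show "real ((n + (n - j) - 1) choose (n - j)) * harm_pow \<mu> (n - (n - j)) * harm_pow (\<mu> - 1) (n + (n - j))
      = real ((2 * n - j - 1) choose (n - 1)) * harm_pow (\<mu> - 1) (2 * n - j) * harm_pow \<mu> j"
      unfolding choose[OF j(1,2)] j(3,4) by simp
  qed
  have A: "(\<Sum>j=0..n - 1. real ((n + j - 1) choose j) * (-1) ^ j * (\<Sum>k=1..n + j. real ((2 * n - k - 1) choose (n - j - 1)) * T k))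
    = (-1) ^ n * (\<Sum>j=1..n. real ((2 * n - j - 1) choose (n - 1)) * (-1) ^ j * (\<Sum>k=1..2 * n - j. real ((2 * n - k - 1) choose (j - 1)) * T k))"
    unfolding reflect sum_distrib_left[where r = "(-1) ^ n"]
  proof (intro sum.cong refl)
    fix j assume "j \<in> {1..n}"
    then have j: "1 \<le> j" "j \<le> n" "n - (n - j) = j" "n + (n - j) = 2 * n - j" by auto
    show "real ((n + (n - j) - 1) choose (n - j)) * (-1) ^ (n - j) * (\<Sum>k=1..n + (n - j). real ((2 * n - k - 1) choose (n - (n - j) - 1)) * T k)
      = (-1) ^ n * (real ((2 * n - j - 1) choose (n - 1)) * (-1) ^ j * (\<Sum>k=1..2 * n - j. real ((2 * n - k - 1) choose (j - 1)) * T k))"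
      unfolding choose[OF j(1,2)] sgn_diff[OF j(2)] j(3,4) by simp
  qed
  have B: "(\<Sum>j=0..n - 1. real ((n + j - 1) choose j) * (-1) ^ j * (\<Sum>k=1..n - j. real ((2 * n - k - 1) choose (n + j - 1)) * T k))
    = (-1) ^ n * (\<Sum>j=1..n. real ((2 * n - j - 1) choose (n - 1)) * (-1) ^ j * (\<Sum>k=1..j. real ((2 * n - k - 1) choose (2 * n - j - 1)) * T k))"
    unfolding reflect sum_distrib_left[where r = "(-1) ^ n"]
  proof (intro sum.cong refl)
    fix j assume "j \<in> {1..n}"
    then have j: "1 \<le> j" "j \<le> n" "n - (n - j) = j" "n + (n - j) = 2 * n - j" by auto
    show "real ((n + (n - j) - 1) choose (n - j)) * (-1) ^ (n - j) * (\<Sum>k=1..n - (n - j). real ((2 * n - k - 1) choose (n + (n - j) - 1)) * T k)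
      = (-1) ^ n * (real ((2 * n - j - 1) choose (n - 1)) * (-1) ^ j * (\<Sum>k=1..j. real ((2 * n - k - 1) choose (2 * n - j - 1)) * T k))"
      unfolding choose[OF j(1,2)] sgn_diff[OF j(2)] j(3,4) by simp
  qed
  \<comment> \<open>Here e stands for (-1)^n, hence - e for (-1)^(n - 1).\<close>
  have combine: "2 * L = h2 - z2 - h * h + z * z + - e * 4 * Z - - e * 2 * P - - e * 2 * A - - e * 2 * B"
    if "L + L = h2 - h * h - z2 + z * z - e * 2 * Z - e * 2 * Z + e * P + e * P + e * A + e * A + e * B + e * B"
    for L h2 z2 h z e Z P A B :: real
    using that by (simp add: algebra_simps)
  show ?thesis
    using suminf_euler_term_formula[OF assms(1) n n]
    unfolding mult_2[of n, symmetric] T Z P A B sgn power2_eq_square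
    by (rule combine)
qed

theorem theorem5p3:
  shows
    "(\<forall>\<mu> n s :: nat. \<mu> \<ge> 1 \<longrightarrow> n \<ge> 2 \<longrightarrow> s \<ge> 2 \<longrightarrow>
        summable (\<lambda>\<nu>. H (Suc \<nu>) (int n) / real (Suc \<nu> + \<mu>) ^ s) \<and>
        summable (\<lambda>\<nu>. H (Suc \<nu>) (int s) / real (Suc \<nu> + \<mu>) ^ n) \<and>
        (\<Sum>\<nu>. H (Suc \<nu>) (int n) / real (Suc \<nu> + \<mu>) ^ s) + (\<Sum>\<nu>. H (Suc \<nu>) (int s) / real (Suc \<nu> + \<mu>) ^ n)
          = H \<mu> (int (n + s)) - H \<mu> (int n) * H \<mu> (int s) - zeta (real (n + s)) + zeta (real n) * zeta (real s)
            - (\<Sum>j=0..n - 2. real ((s + j - 1) choose j) * ((-1) ^ j + (-1) ^ s) * zeta (real (n - j)) * H (\<mu> - 1) (int (s + j)))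
            - (\<Sum>j=0..s - 2. real ((n + j - 1) choose j) * ((-1) ^ j + (-1) ^ n) * zeta (real (s - j)) * H (\<mu> - 1) (int (n + j)))
            + (-1) ^ n * (\<Sum>j=0..s - 1. real ((n + j - 1) choose j) * H \<mu> (int (s - j)) * H (\<mu> - 1) (int (n + j)))
            + (-1) ^ s * (\<Sum>j=0..n - 1. real ((s + j - 1) choose j) * H \<mu> (int (n - j)) * H (\<mu> - 1) (int (s + j)))
            + (\<Sum>j=0..n - 1. real ((s + j - 1) choose j) * (-1) ^ j *
                (\<Sum>k=1..s + j. real ((n + s - k - 1) choose (n - j - 1)) * (\<Sum>i=1..\<mu>. H (i - 1) (int k) / real i ^ (n + s - k))))
            + (\<Sum>j=0..s - 1. real ((n + j - 1) choose j) * (-1) ^ j *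
                (\<Sum>k=1..n + j. real ((n + s - k - 1) choose (s - j - 1)) * (\<Sum>i=1..\<mu>. H (i - 1) (int k) / real i ^ (n + s - k))))
            + (\<Sum>j=0..n - 1. real ((s + j - 1) choose j) * (-1) ^ j *
                (\<Sum>k=1..n - j. real ((n + s - k - 1) choose (s + j - 1)) * (\<Sum>i=1..\<mu>. H (i - 1) (int k) / real i ^ (n + s - k))))
            + (\<Sum>j=0..s - 1. real ((n + j - 1) choose j) * (-1) ^ j *
                (\<Sum>k=1..s - j. real ((n + s - k - 1) choose (n + j - 1)) * (\<Sum>i=1..\<mu>. H (i - 1) (int k) / real i ^ (n + s - k)))))
     \<and>
     (\<forall>n s :: nat. n \<ge> 2 \<longrightarrow> s \<ge> 2 \<longrightarrow>
        (\<Sum>\<nu>. H (Suc \<nu>) (int n) / real (Suc \<nu> + 1) ^ s) + (\<Sum>\<nu>. H (Suc \<nu>) (int s) / real (Suc \<nu> + 1) ^ n)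
          = zeta (real n) * zeta (real s) - zeta (real (n + s)))
     \<and>
     (\<forall>\<mu> n :: nat. \<mu> \<ge> 1 \<longrightarrow> n \<ge> 2 \<longrightarrow>
        2 * (\<Sum>\<nu>. H (Suc \<nu>) (int n) / real (Suc \<nu> + \<mu>) ^ n)
          = H \<mu> (int (2 * n)) - zeta (real (2 * n)) - (H \<mu> (int n))\<^sup>2 + (zeta (real n))\<^sup>2
            + (-1) ^ (n - 1) * 4 * (\<Sum>j=1..n div 2. real ((2 * n - 2 * j - 1) choose (n - 1)) * zeta (real (2 * j)) * H (\<mu> - 1) (int (2 * n - 2 * j)))
            - (-1) ^ (n - 1) * 2 * (\<Sum>j=1..n. real ((2 * n - j - 1) choose (n - 1)) * H (\<mu> - 1) (int (2 * n - j)) * H \<mu> (int j))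
            - (-1) ^ (n - 1) * 2 * (\<Sum>j=1..n. real ((2 * n - j - 1) choose (n - 1)) * (-1) ^ j *
                (\<Sum>k=1..2 * n - j. real ((2 * n - k - 1) choose (j - 1)) * (\<Sum>i=1..\<mu>. H (i - 1) (int k) / real i ^ (2 * n - k))))
            - (-1) ^ (n - 1) * 2 * (\<Sum>j=1..n. real ((2 * n - j - 1) choose (n - 1)) * (-1) ^ j *
                (\<Sum>k=1..j. real ((2 * n - k - 1) choose (2 * n - j - 1)) * (\<Sum>i=1..\<mu>. H (i - 1) (int k) / real i ^ (2 * n - k)))))"
proof -
  have summand: "H (Suc \<nu>) (int n) / real (Suc \<nu> + \<mu>) ^ s = euler_term n s \<mu> \<nu>" for \<nu> \<mu> n s
    by (simp add: euler_term_def H_int)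
  show ?thesis
    \<comment> \<open>The series are folded into \<open>euler_term\<close> first, while their
      numerators still have the form that \<open>summand\<close> matches.\<close>
    unfolding summand unfolding H_int
    by (intro conjI allI impI summable_euler_term suminf_euler_term_formula
        suminf_euler_term_1 suminf_euler_term_diagonal)
qed

end
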